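(* Let $Z:[0,T]\to\mathbb R^m$ be the first component of an $\mathbf X$-controlled rough path (in particular $Z$ is $\alpha$-Hölder), let $\pi_h=\{0=t_0<t_1<\cdots<t_N=T\}$ be a partition, and let $Z^h$ be the piecewise linear interpolation of $Z$ along $\pi_h$. For every $\tau\in\mathcal T$ and every mesh interval $[t_n,t_{n+1}]$ of $\pi_h$, $$Z^{h,\tau}_{t_n,t_{n+1}}=\frac1{\gamma(\tau)}\prod_{v\in V(\tau)}\Delta Z_n^{\ell(v)},$$ where $V(\tau)$ is the set of vertices of $\tau$, $\ell(v)\in\mathcal A=\{1,\dots,m\}$ is the label of $v$, and $\gamma(\tau)$ is the tree factorial.
   Context: $\alpha\in(1/3,1/2]$. An $\alpha$-Hölder rough path $\mathbf X=(X,\mathbb X)$ over $\mathbb R^d$ consists of $X\in C^\alpha([0,T];\mathbb R^d)$ and a $2\alpha$-Hölder two-parameter $\mathbb X$ with values in $\mathbb R^{d\times d}$ satisfying Chen's identity $\mathbb X_{s,t}=\mathbb X_{s,u}+\mathbb X_{u,t}+X_{s,u}\otimes X_{u,t}$. An $\mathbf X$-controlled rough path is a pair $(Z,Z')$ of $\alpha$-Hölder paths such that $Z_t-Z_s-Z'_s(X_t-X_s)$ is $2\alpha$-Hölder. Put $h_n=t_{n+1}-t_n$ and $\Delta Z_n=Z_{t_{n+1}}-Z_{t_n}$, with components $\Delta Z_n^a$. Then $Z^h_t:=Z_{t_n}+\frac{t-t_n}{h_n}\Delta Z_n$ for $t\in(t_n,t_{n+1}]$, $Z^h_0=Z_0$.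 $\mathcal T$ is the set of (nonplanar) rooted trees with vertices decorated by $\mathcal A=\{1,\dots,m\}$; $\mathbf 1$ is the empty tree/forest; $[\tau_1\cdots\tau_n]_a$ is the tree obtained by joining the roots of $\tau_1,\dots,\tau_n$ to a new root decorated by $a$; $\bullet_a=[\mathbf 1]_a$; $|\tau|$ is the number of vertices. Tree factorial: $\gamma(\mathbf 1)=\gamma(\bullet_a)=1$, $\gamma([\tau_1\cdots\tau_k]_a)=|[\tau_1\cdots\tau_k]_a|\prod_{i=1}^k\gamma(\tau_i)$. $Z^h$ is regarded as the $\mathbf X$-controlled path $(Z^h,0)$ with zero Gubinelli derivative. On a mesh interval with $u=t_n$ and $r\in[t_n,t_{n+1}]$ the coefficients are defined recursively by $Z^{h,\mathbf 1}_{u,r}=1$, $Z^{h,\tau_1\cdots\tau_k}_{u,r}=\prod_jZ^{h,\tau_j}_{u,r}$, and $Z^{h,[\eta]_a}_{u,r}=\int_u^rZ^{h,\eta}_{u,s}\,dZ^{h,a}_s$, the integral being the controlled rough integral against $(Z^{h,a},0)$, i.e. the limit of $\sum_{[s,t]}(H_s(W_t-W_s)+(H'_s\diamond W'_s)\mathbb X_{s,t})$ with $(A\diamond B)(x\otimes\tilde x)=A(x)(B\tilde x)$; here $W'=0$, so it coincides with the ordinary Riemann-Stieltjes integral. *)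

theory Defs
  imports "HOL-Analysis.Analysis" "HOL-Library.Multiset"
begin

section \<open>Rough paths and controlled paths\<close>

definition holder_path :: "real \<Rightarrow> real \<Rightarrow> (real \<Rightarrow> 'a::real_normed_vector) \<Rightarrow> bool" where
  "holder_path \<beta> T f \<longleftrightarrow>
     (\<exists>C. \<forall>s\<in>{0..T}. \<forall>t\<in>{0..T}. norm (f t - f s) \<le> C * \<bar>t - s\<bar> powr \<beta>)"

text \<open>Two-parameter objects are only looked at on the simplex \<open>0 \<le> s \<le> t \<le> T\<close>.\<close>

definition holder_two_param :: "real \<Rightarrow> real \<Rightarrow> (real \<Rightarrow> real \<Rightarrow> 'a::real_normed_vector) \<Rightarrow> bool" where
  "holder_two_param \<beta> T R \<longleftrightarrow>
     (\<exists>C. \<forall>s t. 0 \<le> s \<and> s \<le> t \<and> t \<le> T \<longrightarrow> norm (R s t) \<le> C * \<bar>t - s\<bar> powr \<beta>)"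

definition tensor :: "real^'d \<Rightarrow> real^'d \<Rightarrow> real^'d^'d" where
  "tensor x y = (\<chi> i j. x $ i * y $ j)"

definition rough_path ::
  "real \<Rightarrow> real \<Rightarrow> (real \<Rightarrow> real^'d) \<Rightarrow> (real \<Rightarrow> real \<Rightarrow> real^'d^'d) \<Rightarrow> bool" where
  "rough_path \<alpha> T X XX \<longleftrightarrow>
     holder_path \<alpha> T X \<and> holder_two_param (2 * \<alpha>) T XX \<and>
     (\<forall>s u t. 0 \<le> s \<and> s \<le> u \<and> u \<le> t \<and> t \<le> T \<longrightarrow>
        XX s t = XX s u + XX u t + tensor (X u - X s) (X t - X u))"

definition controlled_path ::
  "real \<Rightarrow> real \<Rightarrow> (real \<Rightarrow> real^'d) \<Rightarrow> (real \<Rightarrow> real^'m) \<Rightarrow> (real \<Rightarrow> real^'d^'m) \<Rightarrow> bool" where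
  "controlled_path \<alpha> T X Z Z' \<longleftrightarrow>
     holder_path \<alpha> T Z \<and> holder_path \<alpha> T Z' \<and>
     holder_two_param (2 * \<alpha>) T (\<lambda>s t. Z t - Z s - Z' s *v (X t - X s))"

section \<open>Partitions and piecewise linear interpolation\<close>

definition partition_of :: "real \<Rightarrow> real \<Rightarrow> nat \<Rightarrow> (nat \<Rightarrow> real) \<Rightarrow> bool" where
  "partition_of a b N t \<longleftrightarrow> t 0 = a \<and> t N = b \<and> (\<forall>i<N. t i < t (Suc i))"

definition lin_interp :: "nat \<Rightarrow> (nat \<Rightarrow> real) \<Rightarrow> (real \<Rightarrow> real^'m) \<Rightarrow> real \<Rightarrow> real^'m" where
  "lin_interp N t Z r =
     (if \<exists>n<N. r \<in> {t n<..t (Suc n)}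
      then let n = (THE n. n < N \<and> r \<in> {t n<..t (Suc n)})
           in Z (t n) + ((r - t n) / (t (Suc n) - t n)) *\<^sub>R (Z (t (Suc n)) - Z (t n))
      else Z 0)"

section \<open>The controlled rough integral\<close>

text \<open>A real-valued controlled path is a pair of a path and its Gubinelli derivative. The
  derivative takes values in the dual of \<open>\<real>\<^sup>d\<close>; a functional is represented by its
  coefficient vector, acting through the inner product.\<close>

type_synonym 'd cpath = "(real \<Rightarrow> real) \<times> (real \<Rightarrow> real^'d)"

definition diamond :: "real^'d \<Rightarrow> real^'d \<Rightarrow> real^'d^'d \<Rightarrow> real" where
  "diamond A B M = (\<Sum>i\<in>UNIV. \<Sum>j\<in>UNIV. A $ i * B $ j * M $ i $ j)"

lemma diamond_tensor: "diamond A B (tensor x y) = (A \<bullet> x) * (B \<bullet> y)"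
  by (simp add: diamond_def tensor_def inner_vec_def sum_product mult_ac)

lemma linear_diamond: "linear (diamond A B)"
  by (rule linearI)
    (simp_all add: diamond_def algebra_simps sum.distrib sum_distrib_left)

definition compensated_sum ::
  "(real \<Rightarrow> real \<Rightarrow> real^'d^'d) \<Rightarrow> 'd cpath \<Rightarrow> 'd cpath \<Rightarrow> nat \<Rightarrow> (nat \<Rightarrow> real) \<Rightarrow> real" where
  "compensated_sum XX H W K p =
     (\<Sum>i<K. (fst H (p i) * (fst W (p (Suc i)) - fst W (p i))
        + diamond (snd H (p i)) (snd W (p i)) (XX (p i) (p (Suc i)))))"

definition has_rough_integral ::
  "(real \<Rightarrow> real \<Rightarrow> real^'d^'d) \<Rightarrow> 'd cpath \<Rightarrow> 'd cpath \<Rightarrow> real \<Rightarrow> real \<Rightarrow> real \<Rightarrow> bool" where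
  "has_rough_integral XX H W u r I \<longleftrightarrow>
     (\<forall>\<epsilon>>0. \<exists>\<delta>>0. \<forall>K p. partition_of u r K p \<and> (\<forall>i<K. p (Suc i) - p i < \<delta>) \<longrightarrow>
        \<bar>compensated_sum XX H W K p - I\<bar> < \<epsilon>)"

definition rough_integral ::
  "(real \<Rightarrow> real \<Rightarrow> real^'d^'d) \<Rightarrow> 'd cpath \<Rightarrow> 'd cpath \<Rightarrow> real \<Rightarrow> real \<Rightarrow> real" where
  "rough_integral XX H W u r = (THE I. has_rough_integral XX H W u r I)"

text \<open>The product of finitely many controlled paths, with the Gubinelli derivative given by the
  Leibniz rule.\<close>

definition cpath_prod :: "('d::finite) cpath multiset \<Rightarrow> 'd cpath" where
  "cpath_prod M =
     (\<lambda>s. \<Prod>p\<in>#M. fst p s,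
      \<lambda>s. \<Sum>p\<in>#M. (\<Prod>q\<in>#M - {#p#}. fst q s) *\<^sub>R snd p s)"

text \<open>The rough integral as a controlled path: the Gubinelli derivative of
  \<open>\<integral> H dW\<close> is \<open>H W'\<close>.\<close>

definition cpath_integral ::
  "(real \<Rightarrow> real \<Rightarrow> real^'d^'d) \<Rightarrow> real \<Rightarrow> 'd cpath \<Rightarrow> 'd cpath \<Rightarrow> 'd cpath" where
  "cpath_integral XX u H W =
     (\<lambda>r. rough_integral XX H W u r, \<lambda>r. fst H r *\<^sub>R snd W r)"

section \<open>Decorated trees and forests\<close>

text \<open>Children form a multiset, so trees are nonplanar. A forest is a multiset of nonempty trees;
  the empty tree is identified with the empty forest, and a nonempty tree with the corresponding
  one-element forest.\<close>

datatype 'a rtree = Node 'a "'a rtree multiset"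

type_synonym 'a forest = "'a rtree multiset"

definition graft :: "'a \<Rightarrow> 'a forest \<Rightarrow> 'a forest" where
  "graft a F = {#Node a F#}"

definition trees :: "'a forest set" where
  "trees = insert {#} {graft a F |a F. True}"

text \<open>The multiset of the decorations \<open>\<ell>(v)\<close> of all vertices \<open>v\<close>; its size is the number of
  vertices.\<close>

primrec tree_labels :: "'a rtree \<Rightarrow> 'a multiset" where
  "tree_labels (Node a F) = add_mset a (sum_mset (image_mset tree_labels F))"

definition labels :: "'a forest \<Rightarrow> 'a multiset" where
  "labels F = sum_mset (image_mset tree_labels F)"

primrec tree_gamma :: "'a rtree \<Rightarrow> nat" where
  "tree_gamma (Node a F) =
     size (tree_labels (Node a F)) * prod_mset (image_mset tree_gamma F)"

definition gamma :: "'a forest \<Rightarrow> nat" where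
  "gamma F = prod_mset (image_mset tree_gamma F)"

lemma gamma_simps:
  "gamma {#} = 1"
  "gamma (graft a {#}) = 1"
  "gamma (graft a F) = size (labels (graft a F)) * (\<Prod>\<tau>\<in>#F. gamma {#\<tau>#})"
  by (simp_all add: gamma_def graft_def labels_def)

section \<open>Tree-indexed coefficients\<close>

text \<open>\<open>forest_coeff XX Y Y' u F\<close> is the coefficient \<open>r \<mapsto> Y\<^sup>F\<^bsub>u,r\<^esub>\<close> of the controlled path
  \<open>(Y, Y')\<close>, together with its Gubinelli derivative.\<close>

primrec tree_coeff ::
  "(real \<Rightarrow> real \<Rightarrow> real^'d^'d) \<Rightarrow> (real \<Rightarrow> real^'m) \<Rightarrow> (real \<Rightarrow> real^'d^'m) \<Rightarrow> real
    \<Rightarrow> 'm rtree \<Rightarrow> 'd cpath" where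
  "tree_coeff XX Y Y' u (Node a F) =
     cpath_integral XX u (cpath_prod (image_mset (tree_coeff XX Y Y' u) F))
       (\<lambda>s. Y s $ a, \<lambda>s. Y' s $ a)"

definition forest_coeff ::
  "(real \<Rightarrow> real \<Rightarrow> real^'d^'d) \<Rightarrow> (real \<Rightarrow> real^'m) \<Rightarrow> (real \<Rightarrow> real^'d^'m) \<Rightarrow> real
    \<Rightarrow> 'm forest \<Rightarrow> 'd cpath" where
  "forest_coeff XX Y Y' u F = cpath_prod (image_mset (tree_coeff XX Y Y' u) F)"

lemma forest_coeff_simps:
  "fst (forest_coeff XX Y Y' u {#}) r = 1"
  "fst (forest_coeff XX Y Y' u F) r = (\<Prod>\<tau>\<in>#F. fst (forest_coeff XX Y Y' u {#\<tau>#}) r)"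
  "forest_coeff XX Y Y' u (graft a F) =
     cpath_integral XX u (forest_coeff XX Y Y' u F) (\<lambda>s. Y s $ a, \<lambda>s. Y' s $ a)"
  by (simp_all add: forest_coeff_def cpath_prod_def graft_def cpath_integral_def
      image_mset.compositionality comp_def)

text \<open>The interpolation \<open>Z\<^sup>h\<close> is regarded as the controlled path \<open>(Z\<^sup>h, 0)\<close>.\<close>

definition interp_coeff ::
  "(real \<Rightarrow> real \<Rightarrow> real^'d^'d) \<Rightarrow> nat \<Rightarrow> (nat \<Rightarrow> real) \<Rightarrow> (real \<Rightarrow> real^'m)
    \<Rightarrow> 'm forest \<Rightarrow> real \<Rightarrow> real \<Rightarrow> real" where
  "interp_coeff XX N t Z \<tau> u r =
     fst (forest_coeff XX (lin_interp N t Z) (\<lambda>_. 0) u \<tau>) r"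

end

theory Submission
  imports Defs
begin

text \<open>
  On a mesh interval the interpolated path is affine and its Gubinelli derivative is zero, so the
  second-order term of every compensated sum vanishes and the rough integral is the limit of
  ordinary left-point Riemann sums (\<open>has_rough_integral_affine\<close>).

  For an affine path \<open>Y\<close> with velocity \<open>d\<close> the coefficient of a tree with \<open>k\<close> vertices at time
  \<open>r\<close> is a constant times \<open>(r - u)\<^sup>k\<close>. Multiplying the coefficients of the children of a root
  adds the exponents, and integrating against the component of \<open>Y\<close> decorating the root multiplies
  by the velocity and divides by the new exponent, which is the number of vertices of the tree.
  This division is exactly the recursion of the tree factorial. Since \<open>(r - u) *\<^sub>R d = Y r - Y u\<close>,
  the result (\<open>tree_coeff_affine\<close>) can be expressed by the increment of \<open>Y\<close> alone. The
  integral up to \<open>r\<close> involves the coefficients of the children at all earlier times, so the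
  induction over trees treats every \<open>r\<close> in the mesh interval; the claim is the value at the right
  endpoint.
\<close>

section \<open>Partitions\<close>

lemma partition_of_mono:
  assumes "partition_of a b K p" "i \<le> j" "j \<le> K"
  shows "p i \<le> p j"
  using assms(2,3)
proof (induction j rule: dec_induct)
  case (step j)
  then have "p j < p (Suc j)"
    using assms(1) by (simp add: partition_of_def)
  with step show ?case by simp
qed simp

lemma partition_of_bounds:
  assumes "partition_of a b K p" "i \<le> K"
  shows "a \<le> p i" "p i \<le> b"
  using partition_of_mono[OF assms(1), of 0 i] partition_of_mono[OF assms(1), of i K] assms
  by (simp_all add: partition_of_def)

lemma partition_of_fine_exists:
  assumes "a \<le> b" "\<delta> > 0"
  shows "\<exists>K p. partition_of a b K p \<and> (\<forall>i<K. p (Suc i) - p i < \<delta>)"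
proof (cases "a = b")
  case True
  then have "partition_of a b 0 (\<lambda>_. a)"
    by (simp add: partition_of_def)
  then show ?thesis by blast
next
  case False
  with assms have ab: "a < b" by simp
  obtain K :: nat where "(b - a) / \<delta> < real K"
    using reals_Archimedean2 by blast
  moreover from this have K: "K > 0"
    using ab assms(2) by (cases K) (auto simp: field_simps)
  ultimately have "(b - a) / real K < \<delta>"
    using assms(2) by (simp add: field_simps)
  moreover have "partition_of a b K (\<lambda>i. a + real i * ((b - a) / real K))"
    using K ab by (simp add: partition_of_def field_simps)
  ultimately show ?thesis
    by (intro exI[of _ K] exI[of _ "\<lambda>i. a + real i * ((b - a) / real K)"])
      (simp add: algebra_simps add_divide_distrib diff_divide_distrib)
qed

section \<open>Rough integrals against affine paths\<close>

text \<open>For \<open>u > r\<close> no partition exists and every number is a limit of the compensated sums; for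
  \<open>u \<le> r\<close> there are arbitrarily fine partitions, on which two limits can be compared.\<close>

lemma has_rough_integral_unique:
  assumes "u \<le> r" "has_rough_integral XX H W u r I" "has_rough_integral XX H W u r J"
  shows "I = J"
proof (rule ccontr)
  assume "I \<noteq> J"
  then have e: "\<bar>I - J\<bar> / 2 > 0" by simp
  obtain \<delta>1 where d1: "\<delta>1 > 0" "\<And>K p. partition_of u r K p \<and> (\<forall>i<K. p (Suc i) - p i < \<delta>1)
      \<Longrightarrow> \<bar>compensated_sum XX H W K p - I\<bar> < \<bar>I - J\<bar> / 2"
    using assms(2) e unfolding has_rough_integral_def by meson
  obtain \<delta>2 where d2: "\<delta>2 > 0" "\<And>K p. partition_of u r K p \<and> (\<forall>i<K. p (Suc i) - p i < \<delta>2)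
      \<Longrightarrow> \<bar>compensated_sum XX H W K p - J\<bar> < \<bar>I - J\<bar> / 2"
    using assms(3) e unfolding has_rough_integral_def by meson
  obtain K p where p: "partition_of u r K p" "\<forall>i<K. p (Suc i) - p i < min \<delta>1 \<delta>2"
    using partition_of_fine_exists[OF assms(1), of "min \<delta>1 \<delta>2"] d1(1) d2(1) by auto
  have "\<bar>compensated_sum XX H W K p - I\<bar> < \<bar>I - J\<bar> / 2"
    using d1(2)[of K p] p by simp
  moreover have "\<bar>compensated_sum XX H W K p - J\<bar> < \<bar>I - J\<bar> / 2"
    using d2(2)[of K p] p by simp
  moreover have "\<bar>I - J\<bar> \<le> \<bar>compensated_sum XX H W K p - I\<bar> + \<bar>compensated_sum XX H W K p - J\<bar>"
    by arith
  ultimately show False by simp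
qed

lemma rough_integral_eqI:
  assumes "u \<le> r" "has_rough_integral XX H W u r I"
  shows "rough_integral XX H W u r = I"
  unfolding rough_integral_def
  using assms has_rough_integral_unique[OF assms(1)] by blast

text \<open>By the mean value theorem each increment of the primitive \<open>F\<close> is the step length times a
  value of \<open>f\<close> in the same subinterval, and uniform continuity makes all these values close to
  those at the left endpoints.\<close>

lemma left_riemann_sum_limit:
  fixes f F :: "real \<Rightarrow> real"
  assumes f: "continuous_on {u..r} f"
    and F: "\<And>s. s \<in> {u..r} \<Longrightarrow> (F has_real_derivative f s) (at s within {u..r})"
    and "\<epsilon> > 0"
  shows "\<exists>\<delta>>0. \<forall>K p. partition_of u r K p \<and> (\<forall>i<K. p (Suc i) - p i < \<delta>) \<longrightarrow>
    \<bar>(\<Sum>i<K. f (p i) * (p (Suc i) - p i)) - (F r - F u)\<bar> < \<epsilon>"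
proof -
  \<comment> \<open>Adding 1 avoids a zero denominator when \<open>u = r\<close> and makes the final inequality strict.\<close>
  define \<eta> where "\<eta> = \<epsilon> / (\<bar>r - u\<bar> + 1)"
  have \<eta>: "\<eta> > 0" using \<open>\<epsilon> > 0\<close> by (simp add: \<eta>_def add_nonneg_pos)
  have "uniformly_continuous_on {u..r} f"
    by (rule compact_uniformly_continuous[OF f]) simp
  then obtain \<delta> where \<delta>: "\<delta> > 0"
    "\<And>x y. x \<in> {u..r} \<Longrightarrow> y \<in> {u..r} \<Longrightarrow> \<bar>y - x\<bar> < \<delta> \<Longrightarrow> \<bar>f y - f x\<bar> < \<eta>"
    using \<eta> unfolding uniformly_continuous_on_def dist_real_def by meson
  have "\<bar>(\<Sum>i<K. f (p i) * (p (Suc i) - p i)) - (F r - F u)\<bar> < \<epsilon>"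
    if p: "partition_of u r K p" and fine: "\<forall>i<K. p (Suc i) - p i < \<delta>" for K p
  proof -
    have step: "\<bar>f (p i) * (p (Suc i) - p i) - (F (p (Suc i)) - F (p i))\<bar>
        \<le> \<eta> * (p (Suc i) - p i)" if "i < K" for i
    proof -
      have lt: "p i < p (Suc i)" using p that by (simp add: partition_of_def)
      have sub: "{p i..p (Suc i)} \<subseteq> {u..r}"
        using partition_of_bounds[OF p, of i] partition_of_bounds[OF p, of "Suc i"] that by auto
      have "\<exists>x\<in>{p i<..<p (Suc i)}. F (p (Suc i)) - F (p i) = (p (Suc i) - p i) * f x"
      proof (rule mvt_simple[OF lt, where f' = "\<lambda>x y. y * f x"])
        fix x assume "p i \<le> x" "x \<le> p (Suc i)"
        then have "x \<in> {u..r}"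
          using sub by auto
        then have "(F has_real_derivative f x) (at x within {p i..p (Suc i)})"
          by (rule DERIV_subset[OF F sub])
        then show "(F has_derivative (\<lambda>y. y * f x)) (at x within {p i..p (Suc i)})"
          by (simp add: has_field_derivative_def mult_commute_abs)
      qed
      then obtain x where x: "x \<in> {p i<..<p (Suc i)}"
        "F (p (Suc i)) - F (p i) = (p (Suc i) - p i) * f x"
        by blast
      have "p i \<in> {u..r}" "x \<in> {u..r}"
        using sub x(1) lt by auto
      moreover have "\<bar>p i - x\<bar> < \<delta>"
        using x(1) fine[rule_format, OF that] by simp
      ultimately have "\<bar>f (p i) - f x\<bar> < \<eta>"
        using \<delta>(2)[of x "p i"] by simp
      then have "\<bar>f (p i) - f x\<bar> * (p (Suc i) - p i) \<le> \<eta> * (p (Suc i) - p i)"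
        using lt by (intro mult_right_mono) auto
      moreover have "f (p i) * (p (Suc i) - p i) - (F (p (Suc i)) - F (p i))
          = (f (p i) - f x) * (p (Suc i) - p i)"
        using x(2) by (simp add: algebra_simps)
      ultimately show ?thesis using lt by (simp add: abs_mult)
    qed
    have ends: "p 0 = u" "p K = r" using p by (auto simp: partition_of_def)
    have "F r - F u = (\<Sum>i<K. F (p (Suc i)) - F (p i))"
      using sum_lessThan_telescope[of "\<lambda>i. F (p i)" K] ends by simp
    then have "\<bar>(\<Sum>i<K. f (p i) * (p (Suc i) - p i)) - (F r - F u)\<bar>
        = \<bar>\<Sum>i<K. f (p i) * (p (Suc i) - p i) - (F (p (Suc i)) - F (p i))\<bar>"
      by (simp add: sum_subtractf)
    also have "\<dots> \<le> (\<Sum>i<K. \<eta> * (p (Suc i) - p i))"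
      by (intro order_trans[OF sum_abs] sum_mono) (use step in auto)
    also have "\<dots> = \<eta> * (r - u)"
      using sum_lessThan_telescope[of p K] ends by (simp add: sum_distrib_left[symmetric])
    also have "\<dots> < \<eta> * (\<bar>r - u\<bar> + 1)"
      using \<eta> by (intro mult_strict_left_mono) auto
    also have "\<dots> = \<epsilon>" by (simp add: \<eta>_def add_nonneg_eq_0_iff)
    finally show ?thesis .
  qed
  with \<delta>(1) show ?thesis by blast
qed

text \<open>The diamond term contains the zero Gubinelli derivative of \<open>W\<close> as a factor, and an increment
  of \<open>W\<close> is \<open>m\<close> times the step length. What remains of a compensated sum is a left-point Riemann
  sum of \<open>m H\<close>.\<close>

lemma has_rough_integral_affine:
  assumes H: "continuous_on {u..r} (fst H)"
    and F: "\<And>s. s \<in> {u..r} \<Longrightarrow> (F has_real_derivative fst H s) (at s within {u..r})"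
    and W: "\<And>s. s \<in> {u..r} \<Longrightarrow> fst W s = w + (s - u) * m" "\<And>s. snd W s = 0"
  shows "has_rough_integral XX H W u r (m * (F r - F u))"
proof -
  have sums: "compensated_sum XX H W K p = (\<Sum>i<K. fst H (p i) * m * (p (Suc i) - p i))"
    if p: "partition_of u r K p" for K p
    unfolding compensated_sum_def
  proof (rule sum.cong[OF refl])
    fix i assume "i \<in> {..<K}"
    then have "p i \<in> {u..r}" "p (Suc i) \<in> {u..r}"
      using partition_of_bounds[OF p] by auto
    then have "fst W (p (Suc i)) - fst W (p i) = m * (p (Suc i) - p i)"
      by (simp only: W(1)) (simp add: algebra_simps)
    then show "fst H (p i) * (fst W (p (Suc i)) - fst W (p i))
        + diamond (snd H (p i)) (snd W (p i)) (XX (p i) (p (Suc i)))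
        = fst H (p i) * m * (p (Suc i) - p i)"
      by (simp add: diamond_def W(2))
  qed
  have "continuous_on {u..r} (\<lambda>s. fst H s * m)"
    by (intro continuous_intros H)
  moreover have "((\<lambda>s. m * F s) has_real_derivative fst H s * m) (at s within {u..r})"
    if "s \<in> {u..r}" for s
    using DERIV_cmult[OF F[OF that], of m] by (simp add: mult.commute)
  ultimately have "\<exists>\<delta>>0. \<forall>K p. partition_of u r K p \<and> (\<forall>i<K. p (Suc i) - p i < \<delta>) \<longrightarrow>
      \<bar>(\<Sum>i<K. fst H (p i) * m * (p (Suc i) - p i)) - (m * F r - m * F u)\<bar> < \<epsilon>"
    if "\<epsilon> > 0" for \<epsilon>
    using that by (rule left_riemann_sum_limit)
  then show ?thesis
    unfolding has_rough_integral_def by (simp add: sums right_diff_distrib cong: conj_cong)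
qed

lemma rough_integral_monomial_affine:
  assumes "u \<le> r"
    and H: "\<And>s. s \<in> {u..r} \<Longrightarrow> fst H s = c * (s - u) ^ k"
    and W: "\<And>s. s \<in> {u..r} \<Longrightarrow> fst W s = w + (s - u) * m" "\<And>s. snd W s = 0"
  shows "rough_integral XX H W u r = m * c * (r - u) ^ Suc k / real (Suc k)"
proof -
  define F where "F = (\<lambda>s. c / real (Suc k) * (s - u) ^ Suc k)"
  have "has_rough_integral XX H W u r (m * (F r - F u))"
  proof (rule has_rough_integral_affine[OF _ _ W])
    have "continuous_on {u..r} (\<lambda>s. c * (s - u) ^ k)"
      by (intro continuous_intros)
    then show "continuous_on {u..r} (fst H)"
      by (rule continuous_on_eq) (simp add: H)
  next
    fix s assume s: "s \<in> {u..r}"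
    have "((\<lambda>s. s - u) has_real_derivative 1) (at s within {u..r})"
      by (auto intro!: derivative_eq_intros)
    from DERIV_cmult[OF DERIV_power_Suc[OF this], of "c / real (Suc k)" k]
    have "(F has_real_derivative c * (s - u) ^ k) (at s within {u..r})"
      by (simp add: F_def)
    then show "(F has_real_derivative fst H s) (at s within {u..r})"
      using H[OF s] by simp
  qed simp_all
  from rough_integral_eqI[OF assms(1) this] show ?thesis
    by (simp add: F_def)
qed

section \<open>Coefficients of affine paths\<close>

lemma prod_mset_scale:
  fixes c :: "'b::comm_semiring_1"
  shows "(\<Prod>a\<in>#M. c * f a) = c ^ size M * (\<Prod>a\<in>#M. f a)"
  by (simp add: prod_mset.distrib)

text \<open>A product over vertices and the tree factorial both split over the trees of a forest, so the
  formula for the individual trees passes to their product. The same multiplicativity serves in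
  the induction below, for the children of a root, and in the final result.\<close>

lemma forest_coeff_of_trees:
  assumes "\<And>\<sigma>. \<sigma> \<in># F \<Longrightarrow> fst (tree_coeff XX Y Y' u \<sigma>) r
    = 1 / real (tree_gamma \<sigma>) * (\<Prod>a\<in>#tree_labels \<sigma>. g a)"
  shows "fst (forest_coeff XX Y Y' u F) r
    = 1 / real (gamma F) * (\<Prod>a\<in>#labels F. g a)"
proof -
  have "fst (forest_coeff XX Y Y' u F) r = (\<Prod>\<sigma>\<in>#F. fst (tree_coeff XX Y Y' u \<sigma>) r)"
    by (simp add: forest_coeff_def cpath_prod_def image_mset.compositionality comp_def)
  also have "\<dots> = (\<Prod>\<sigma>\<in>#F. 1 / real (tree_gamma \<sigma>) * (\<Prod>a\<in>#tree_labels \<sigma>. g a))"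
    by (intro arg_cong[where f = prod_mset] image_mset_cong assms)
  also have "\<dots> = 1 / real (gamma F) * (\<Prod>a\<in>#labels F. g a)"
    by (induction F) (simp_all add: gamma_def labels_def)
  finally show ?thesis .
qed

text \<open>The integrand attached to the root is a monomial whose degree is the number of vertices of
  the forest of children, so its integral acquires the number of vertices of the whole tree in the
  denominator: the outermost factor of the tree factorial.\<close>

lemma tree_coeff_affine:
  fixes Y :: "real \<Rightarrow> real^'m" and XX :: "real \<Rightarrow> real \<Rightarrow> real^'d^'d"
  assumes Y: "\<And>s. s \<in> {u..v} \<Longrightarrow> Y s = Y u + (s - u) *\<^sub>R d"
    and "r \<in> {u..v}"
  shows "fst (tree_coeff XX Y (\<lambda>_. 0) u \<sigma>) r
    = 1 / real (tree_gamma \<sigma>) * (\<Prod>a\<in>#tree_labels \<sigma>. (Y r - Y u) $ a)"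
  using assms(2)
proof (induction \<sigma> arbitrary: r)
  case (Node a F)
  define c where "c = 1 / real (gamma F) * (\<Prod>b\<in>#labels F. d $ b)"
  let ?k = "size (labels F)"
  have H: "fst (forest_coeff XX Y (\<lambda>_. 0) u F) s = c * (s - u) ^ ?k" if s: "s \<in> {u..r}" for s
  proof -
    have sv: "s \<in> {u..v}" using s Node.prems by simp
    then have "fst (forest_coeff XX Y (\<lambda>_. 0) u F) s
        = 1 / real (gamma F) * (\<Prod>b\<in>#labels F. (Y s - Y u) $ b)"
      by (intro forest_coeff_of_trees Node.IH)
    then show ?thesis
      by (simp add: Y[OF sv] prod_mset_scale c_def)
  qed
  have W: "fst (\<lambda>s. Y s $ a, \<lambda>s. (0 :: real^'d^'m) $ a) s = Y u $ a + (s - u) * d $ a"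
    if "s \<in> {u..r}" for s
    using arg_cong[OF Y[of s], of "\<lambda>y. y $ a"] that Node.prems by simp
  have "fst (tree_coeff XX Y (\<lambda>_. 0) u (Node a F)) r
      = rough_integral XX (forest_coeff XX Y (\<lambda>_. 0) u F)
          (\<lambda>s. Y s $ a, \<lambda>s. (0 :: real^'d^'m) $ a) u r"
    by (simp add: cpath_integral_def forest_coeff_def)
  also have "\<dots> = d $ a * c * (r - u) ^ Suc ?k / real (Suc ?k)"
    by (rule rough_integral_monomial_affine[OF _ H W]) (use Node.prems in auto)
  also have "\<dots> = 1 / real (tree_gamma (Node a F))
      * (\<Prod>b\<in>#tree_labels (Node a F). (Y r - Y u) $ b)"
  proof -
    have Yr: "(Y r - Y u) $ b = (r - u) * d $ b" for b
      using Node.prems by (simp add: Y[of r])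
    show ?thesis
      unfolding Yr prod_mset_scale c_def
      by (simp add: gamma_def[symmetric] labels_def[symmetric] mult_ac
        del: of_nat_Suc mult_Suc mult_Suc_right)
  qed
  finally show ?case .
qed

section \<open>The piecewise linear interpolation\<close>

text \<open>The left endpoint belongs to the preceding half-open interval, or to none if it is the
  starting point; the affine formula holds there too because the interpolation is continuous.\<close>

lemma lin_interp_affine:
  assumes part: "partition_of 0 T N t" and n: "n < N" and s: "s \<in> {t n..t (Suc n)}"
  shows "lin_interp N t Z s
    = Z (t n) + ((s - t n) / (t (Suc n) - t n)) *\<^sub>R (Z (t (Suc n)) - Z (t n))"
proof -
  have formula: "lin_interp N t Z s
      = Z (t k) + ((s - t k) / (t (Suc k) - t k)) *\<^sub>R (Z (t (Suc k)) - Z (t k))"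
    if k: "k < N" "s \<in> {t k<..t (Suc k)}" for k and s
  proof -
    have "(THE k. k < N \<and> s \<in> {t k<..t (Suc k)}) = k"
    proof (rule the_equality)
      fix j assume j: "j < N \<and> s \<in> {t j<..t (Suc j)}"
      have "\<not> j < k" "\<not> k < j"
        using partition_of_mono[OF part, of "Suc j" k] partition_of_mono[OF part, of "Suc k" j] j k
        by auto
      then show "j = k" by simp
    qed (use k in simp)
    then show ?thesis
      using k by (auto simp: lin_interp_def Let_def)
  qed
  show ?thesis
  proof (cases "s = t n")
    case False
    with s n show ?thesis by (intro formula) auto
  next
    case True
    have "lin_interp N t Z (t n) = Z (t n)"
    proof (cases n)
      case 0
      have "t 0 \<notin> {t k<..t (Suc k)}" if "k < N" for k
        using partition_of_mono[OF part, of 0 k] that by simp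
      then have "lin_interp N t Z (t 0) = Z 0"
        unfolding lin_interp_def by (intro if_not_P) blast
      with 0 part show ?thesis
        by (simp add: partition_of_def)
    next
      case (Suc k)
      then have "t k < t (Suc k)" using part n by (simp add: partition_of_def)
      with formula[of k "t n"] Suc n show ?thesis by simp
    qed
    with True show ?thesis by simp
  qed
qed

theorem proposition5p1:
  fixes \<alpha> T :: real
    and X :: "real \<Rightarrow> real^'d" and XX :: "real \<Rightarrow> real \<Rightarrow> real^'d^'d"
    and Z :: "real \<Rightarrow> real^'m" and Z' :: "real \<Rightarrow> real^'d^'m"
    and t :: "nat \<Rightarrow> real" and N n :: nat and \<tau> :: "'m forest"
  assumes "1/3 < \<alpha>" "\<alpha> \<le> 1/2"
    and "rough_path \<alpha> T X XX"
    and "controlled_path \<alpha> T X Z Z'"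
    and "partition_of 0 T N t"
    and "\<tau> \<in> trees"
    and "n < N"
  shows "interp_coeff XX N t Z \<tau> (t n) (t (Suc n)) =
    1 / real (gamma \<tau>) * (\<Prod>a\<in>#labels \<tau>. (Z (t (Suc n)) - Z (t n)) $ a)"
proof -
  let ?Y = "lin_interp N t Z"
  define d where "d = (1 / (t (Suc n) - t n)) *\<^sub>R (Z (t (Suc n)) - Z (t n))"
  have lt: "t n < t (Suc n)" using assms(5,7) by (simp add: partition_of_def)
  note affine = lin_interp_affine[OF assms(5,7), of _ Z]
  have left: "?Y (t n) = Z (t n)" and right: "?Y (t (Suc n)) = Z (t (Suc n))"
    using affine[of "t n"] affine[of "t (Suc n)"] lt by simp_all
  have Y: "?Y s = ?Y (t n) + (s - t n) *\<^sub>R d" if "s \<in> {t n..t (Suc n)}" for s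
    using affine[OF that] by (simp add: left d_def)
  have "fst (forest_coeff XX ?Y (\<lambda>_. 0) (t n) \<tau>) (t (Suc n))
      = 1 / real (gamma \<tau>) * (\<Prod>a\<in>#labels \<tau>. (?Y (t (Suc n)) - ?Y (t n)) $ a)"
    using lt by (intro forest_coeff_of_trees tree_coeff_affine[OF Y]) auto
  then show ?thesis
    by (simp add: interp_coeff_def left right)
qed

end
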